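(* Let $M\subset\mathbb{R}^n$ be a compact domain with smooth nonempty boundary (with the Euclidean metric) and let $p\in\{0,\dots,n\}$. Then the eigenvalues of the biharmonic Steklov problem on $p$-forms on $M$ coincide with the eigenvalues of the scalar biharmonic Steklov problem on $M$ (the case $p=0$), their multiplicities being ignored; that is, a real number $q$ is an eigenvalue of the problem on $p$-forms if and only if it is an eigenvalue of the problem on functions.
   Context: Let $\nu$ be the inward unit normal along $\partial M$, $\iota:\partial M\to M$ the inclusion, $\lrcorner$ the interior product, $\delta$ the codifferential, $\Delta=d\delta+\delta d$ (so $\Delta f=-\mathrm{tr}\nabla^2f$ on functions). The biharmonic Steklov problem on $p$-forms is $$\Delta^2 \omega=0\ \text{on } M,\quad \omega=0\ \text{on }\partial M,\quad \nu\lrcorner\Delta\omega+q\,\iota^*\delta\omega=0\ \text{on }\partial M,\quad \iota^*\Delta \omega-q\,\nu\lrcorner d\omega=0\ \text{on }\partial M.$$ A number $q\in\mathbb R$ is an eigenvalue if a nontrivial smooth $p$-form $\omega$ solving it exists. For $p=0$ it is the scalar problem: $\Delta^2 f=0$ on $M$, $f=0$ on $\partial M$, $\Delta f-q\frac{\partial f}{\partial\nu}=0$ on $\partial M$. *)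

theory Defs
  imports "HOL-Analysis.Analysis"
begin

section \<open>Smooth functions and regions with smooth boundary\<close>

primrec Ck_on :: "nat \<Rightarrow> ('a::euclidean_space \<Rightarrow> real) \<Rightarrow> 'a set \<Rightarrow> bool" where
  "Ck_on 0 f U \<longleftrightarrow> continuous_on U f"
| "Ck_on (Suc k) f U \<longleftrightarrow> (\<forall>x\<in>U. f differentiable at x) \<and>
     (\<forall>v. Ck_on k (\<lambda>x. frechet_derivative f (at x) v) U)"

text \<open>Only meaningful for open \<open>U\<close>, since the derivatives are taken at full neighbourhoods.\<close>

definition smooth_on :: "('a::euclidean_space \<Rightarrow> real) \<Rightarrow> 'a set \<Rightarrow> bool" where
  "smooth_on f U \<longleftrightarrow> (\<forall>k. Ck_on k f U)"

definition local_defining_function ::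
    "'a::euclidean_space set \<Rightarrow> 'a \<Rightarrow> 'a set \<Rightarrow> ('a \<Rightarrow> real) \<Rightarrow> bool" where
  "local_defining_function M x U \<rho> \<longleftrightarrow>
     open U \<and> x \<in> U \<and> smooth_on \<rho> U \<and>
     (\<forall>y\<in>U. \<not> (GDERIV \<rho> y :> 0)) \<and>
     M \<inter> U = {y\<in>U. \<rho> y \<ge> 0}"

text \<open>\<open>M\<close> is a codimension-0 submanifold with boundary; the manifold boundary is then
  the topological one, \<open>frontier M\<close>.\<close>

definition smooth_boundary :: "'a::euclidean_space set \<Rightarrow> bool" where
  "smooth_boundary M \<longleftrightarrow> (\<forall>x\<in>frontier M. \<exists>U \<rho>. local_defining_function M x U \<rho>)"

text \<open>The normalised gradient of a local defining function does not depend on the function.\<close>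

definition inward_unit_normal :: "'a::euclidean_space set \<Rightarrow> 'a \<Rightarrow> 'a" where
  "inward_unit_normal M x = (THE \<nu>. norm \<nu> = 1 \<and>
     (\<exists>U \<rho> c. local_defining_function M x U \<rho> \<and> c > 0 \<and> GDERIV \<rho> x :> c *\<^sub>R \<nu>))"

definition boundary_tangent_space :: "'a::euclidean_space set \<Rightarrow> 'a \<Rightarrow> 'a set" where
  "boundary_tangent_space M x = {v. v \<bullet> inward_unit_normal M x = 0}"

section \<open>Differential forms on open subsets of Euclidean space\<close>

text \<open>A \<open>p\<close>-covector is an alternating \<open>p\<close>-linear function of a list of \<open>p\<close> vectors, extended
  by 0 to lists of any other length. With this convention the formulas below need no
  degree argument, and a form of degree -1 is zero.\<close>

type_synonym 'a covector = "'a list \<Rightarrow> real"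

definition alternating_covector :: "nat \<Rightarrow> 'a::euclidean_space covector \<Rightarrow> bool" where
  "alternating_covector p \<alpha> \<longleftrightarrow>
     (\<forall>vs. length vs \<noteq> p \<longrightarrow> \<alpha> vs = 0) \<and>
     (\<forall>vs i. length vs = p \<longrightarrow> i < p \<longrightarrow> linear (\<lambda>v. \<alpha> (vs[i := v]))) \<and>
     (\<forall>vs. length vs = p \<longrightarrow> \<not> distinct vs \<longrightarrow> \<alpha> vs = 0)"

definition smooth_form_on :: "nat \<Rightarrow> 'a::euclidean_space set \<Rightarrow> ('a \<Rightarrow> 'a covector) \<Rightarrow> bool" where
  "smooth_form_on p U \<omega> \<longleftrightarrow>
     (\<forall>x\<in>U. alternating_covector p (\<omega> x)) \<and> (\<forall>vs. smooth_on (\<lambda>x. \<omega> x vs) U)"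

definition interior_product :: "'a \<Rightarrow> 'a covector \<Rightarrow> 'a covector" where
  "interior_product v \<alpha> = (\<lambda>vs. \<alpha> (v # vs))"

text \<open>\<open>d\<omega>(v\<^sub>0, \<dots>, v\<^sub>p) = \<Sum>\<^sub>i (-1)\<^sup>i D\<^bsub>v i\<^esub> \<omega>(v\<^sub>0, \<dots>, v\<^sub>p)\<close> with \<open>v\<^sub>i\<close> omitted from the arguments
  of \<open>\<omega>\<close> (the bracket terms vanish for constant vector fields).\<close>

definition exterior_derivative ::
    "('a::euclidean_space \<Rightarrow> 'a covector) \<Rightarrow> 'a \<Rightarrow> 'a covector" where
  "exterior_derivative \<omega> x = (\<lambda>vs. \<Sum>i<length vs. (-1) ^ i *
     frechet_derivative (\<lambda>y. \<omega> y (take i vs @ drop (Suc i) vs)) (at x) (vs ! i))"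

text \<open>\<open>\<delta> = - \<Sum>\<^sub>e e \<lrcorner> \<nabla>\<^sub>e\<close> over an orthonormal basis, with the flat connection.\<close>

definition codifferential ::
    "('a::euclidean_space \<Rightarrow> 'a covector) \<Rightarrow> 'a \<Rightarrow> 'a covector" where
  "codifferential \<omega> x =
     (\<lambda>vs. - (\<Sum>e\<in>Basis. frechet_derivative (\<lambda>y. \<omega> y (e # vs)) (at x) e))"

definition hodge_laplacian ::
    "('a::euclidean_space \<Rightarrow> 'a covector) \<Rightarrow> 'a \<Rightarrow> 'a covector" where
  "hodge_laplacian \<omega> x = (\<lambda>vs. exterior_derivative (codifferential \<omega>) x vs
     + codifferential (exterior_derivative \<omega>) x vs)"

section \<open>The biharmonic Steklov problems\<close>

text \<open>Smooth forms on the closed region \<open>M\<close> are restrictions of smooth forms on open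
  neighbourhoods \<open>U\<close>; all their derivatives at points of \<open>M\<close> are determined by their values
  on \<open>M\<close>. The pullback to the boundary is evaluation on tangent vectors of the boundary.\<close>

definition biharmonic_steklov_eigenvalue_forms ::
    "'a::euclidean_space set \<Rightarrow> nat \<Rightarrow> real \<Rightarrow> bool" where
  "biharmonic_steklov_eigenvalue_forms M p q \<longleftrightarrow>
     (\<exists>U \<omega>. open U \<and> M \<subseteq> U \<and> smooth_form_on p U \<omega> \<and>
        (\<exists>x\<in>M. \<exists>vs. \<omega> x vs \<noteq> 0) \<and>
        (\<forall>x\<in>M. \<forall>vs. hodge_laplacian (hodge_laplacian \<omega>) x vs = 0) \<and>
        (\<forall>x\<in>frontier M. \<forall>vs. \<omega> x vs = 0) \<and>
        (\<forall>x\<in>frontier M. \<forall>vs\<in>lists (boundary_tangent_space M x).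
           interior_product (inward_unit_normal M x) (hodge_laplacian \<omega> x) vs
             + q * codifferential \<omega> x vs = 0) \<and>
        (\<forall>x\<in>frontier M. \<forall>vs\<in>lists (boundary_tangent_space M x).
           hodge_laplacian \<omega> x vs
             - q * interior_product (inward_unit_normal M x) (exterior_derivative \<omega> x) vs = 0))"

text \<open>\<open>- tr \<nabla>\<^sup>2 f\<close>\<close>

definition laplacian :: "('a::euclidean_space \<Rightarrow> real) \<Rightarrow> 'a \<Rightarrow> real" where
  "laplacian f x = - (\<Sum>e\<in>Basis.
     frechet_derivative (\<lambda>y. frechet_derivative f (at y) e) (at x) e)"

definition biharmonic_steklov_eigenvalue_functions ::
    "'a::euclidean_space set \<Rightarrow> real \<Rightarrow> bool" where
  "biharmonic_steklov_eigenvalue_functions M q \<longleftrightarrow>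
     (\<exists>U f. open U \<and> M \<subseteq> U \<and> smooth_on f U \<and>
        (\<exists>x\<in>M. f x \<noteq> 0) \<and>
        (\<forall>x\<in>M. laplacian (laplacian f) x = 0) \<and>
        (\<forall>x\<in>frontier M. f x = 0) \<and>
        (\<forall>x\<in>frontier M.
           laplacian f x - q * frechet_derivative f (at x) (inward_unit_normal M x) = 0))"

end

(* In flat space the Hodge Laplacian acts on the components of a form. If the form vanishes on the
   boundary, the derivative of each component there is normal, so d and delta reduce to the normal
   derivative and the two boundary conditions say that the scalar Steklov condition holds for the
   tangential components and for those with one normal argument. By alternation these are all the
   components. Conversely, a scalar solution times a constant nonzero covector is a solution on
   forms. *)

theory Submission
  imports Defs
begin

section \<open>Smooth functions and symmetry of second derivatives\<close>

text \<open>At a boundary point the normal is frozen to a constant vector, so a component with the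
  normal among its arguments is again a scalar function and no derivative of the normal field
  enters. The scalar boundary expression is linear in the form, hence alternating in the arguments;
  this is what lets two conditions on special argument lists control all of them. The analytic input
  is drawn from the definitions. Smoothness is phrased through iterated directional derivatives, so
  the symmetry of second derivatives is derived by a mean value argument. The boundary is given by
  local defining functions; their sign along rays yields both the uniqueness of the normal and the
  vanishing of tangential derivatives.\<close>

abbreviation dd :: "'a::euclidean_space \<Rightarrow> ('a \<Rightarrow> real) \<Rightarrow> 'a \<Rightarrow> real" where
  "dd v f x \<equiv> frechet_derivative f (at x) v"

section \<open>Rules for directional derivatives and closure properties of smooth functions\<close>

lemma dd_linear:
  assumes "f differentiable at x"
  shows "dd (v + w) f x = dd v f x + dd w f x" "dd (c *\<^sub>R v) f x = c * dd v f x"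
  using linear_frechet_derivative[OF assms] by (simp_all add: linear_add linear_cmul)

lemma dd_add:
  assumes "f differentiable at x" "g differentiable at x"
  shows "dd v (\<lambda>y. f y + g y) x = dd v f x + dd v g x"
proof -
  have "((\<lambda>y. f y + g y) has_derivative (\<lambda>v. dd v f x + dd v g x)) (at x)"
    using assms frechet_derivative_works by (intro has_derivative_add) auto
  from fun_cong[OF frechet_derivative_at[OF this], of v] show ?thesis
    by simp
qed

lemma dd_cmult:
  assumes "f differentiable at x"
  shows "dd v (\<lambda>y. c * f y) x = c * dd v f x"
proof -
  have "((\<lambda>y. c * f y) has_derivative (\<lambda>v. c * dd v f x)) (at x)"
    using assms frechet_derivative_works by (intro has_derivative_mult_right) auto
  from fun_cong[OF frechet_derivative_at[OF this], of v] show ?thesis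
    by simp
qed

lemma dd_uminus:
  assumes "f differentiable at x"
  shows "dd v (\<lambda>y. - f y) x = - dd v f x"
  using dd_cmult[OF assms, where c = "-1"] by simp

lemma dd_sum:
  assumes "\<And>i. i \<in> I \<Longrightarrow> f i differentiable at x"
  shows "dd v (\<lambda>y. \<Sum>i\<in>I. f i y) x = (\<Sum>i\<in>I. dd v (f i) x)"
proof -
  have "((\<lambda>y. \<Sum>i\<in>I. f i y) has_derivative (\<lambda>v. \<Sum>i\<in>I. dd v (f i) x)) (at x)"
    using assms frechet_derivative_works by (intro has_derivative_sum) auto
  from fun_cong[OF frechet_derivative_at[OF this], of v] show ?thesis
    by simp
qed

lemma dd_cong:
  assumes "f differentiable at x" "open U" "x \<in> U" "\<And>y. y \<in> U \<Longrightarrow> f y = g y"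
  shows "dd v f x = dd v g x"
  using frechet_derivative_transform_within_open[OF assms] by simp

text \<open>The differentiation rules equate functions on \<open>U\<close> only. Transfer along such
  an equality lets the closure lemmas replace a derivative by its computed form inside the induction
  on \<open>k\<close>.\<close>

lemma Ck_on_cong:
  assumes "open U" "\<And>x. x \<in> U \<Longrightarrow> f x = g x" "Ck_on k f U"
  shows "Ck_on k g U"
  using assms(2,3)
proof (induction k arbitrary: f g)
  case 0
  then show ?case
    using continuous_on_cong by fastforce
next
  case (Suc k)
  have "g differentiable at x" if "x \<in> U" for x
  proof -
    have "f differentiable at x"
      using Suc.prems that by simp
    then have "(f has_derivative frechet_derivative f (at x)) (at x)"
      using frechet_derivative_works by blast
    then have "(g has_derivative frechet_derivative f (at x)) (at x)"
      by (rule has_derivative_transform_within_open[OF _ assms(1) that Suc.prems(1)])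
    then show ?thesis
      by (rule differentiableI)
  qed
  moreover have "Ck_on k (dd v g) U" for v
  proof (rule Suc.IH)
    show "Ck_on k (dd v f) U"
      using Suc.prems by simp
    show "dd v f x = dd v g x" if "x \<in> U" for x
      using that Suc.prems assms(1) by (intro dd_cong) auto
  qed
  ultimately show ?case by simp
qed

lemma Ck_on_const: "Ck_on k (\<lambda>x. c) U"
  by (induction k arbitrary: c) auto

lemma Ck_on_add:
  assumes "open U" "Ck_on k f U" "Ck_on k g U"
  shows "Ck_on k (\<lambda>x. f x + g x) U"
  using assms(2,3)
proof (induction k arbitrary: f g)
  case 0
  then show ?case by (auto intro: continuous_intros)
next
  case (Suc k)
  have "Ck_on k (dd v (\<lambda>x. f x + g x)) U" for v
  proof (rule Ck_on_cong[OF assms(1)])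
    show "Ck_on k (\<lambda>x. dd v f x + dd v g x) U"
      using Suc by simp
    show "dd v f x + dd v g x = dd v (\<lambda>x. f x + g x) x" if "x \<in> U" for x
      using that Suc.prems by (simp add: dd_add)
  qed
  then show ?case using Suc.prems by simp
qed

lemma Ck_on_cmult:
  assumes "open U" "Ck_on k f U"
  shows "Ck_on k (\<lambda>x. c * f x) U"
  using assms(2)
proof (induction k arbitrary: f)
  case 0
  then show ?case by (auto intro: continuous_intros)
next
  case (Suc k)
  have "Ck_on k (dd v (\<lambda>x. c * f x)) U" for v
  proof (rule Ck_on_cong[OF assms(1)])
    show "Ck_on k (\<lambda>x. c * dd v f x) U"
      using Suc by simp
    show "c * dd v f x = dd v (\<lambda>x. c * f x) x" if "x \<in> U" for x
      using that Suc.prems by (simp add: dd_cmult)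
  qed
  then show ?case using Suc.prems by simp
qed

lemma smooth_on_cong:
  assumes "open U" "\<And>x. x \<in> U \<Longrightarrow> f x = g x" "smooth_on f U"
  shows "smooth_on g U"
  using Ck_on_cong assms unfolding smooth_on_def by blast

lemma smooth_on_const: "smooth_on (\<lambda>x. c) U"
  by (simp add: smooth_on_def Ck_on_const)

lemma smooth_on_add:
  "open U \<Longrightarrow> smooth_on f U \<Longrightarrow> smooth_on g U \<Longrightarrow> smooth_on (\<lambda>x. f x + g x) U"
  by (simp add: smooth_on_def Ck_on_add)

lemma smooth_on_cmult:
  "open U \<Longrightarrow> smooth_on f U \<Longrightarrow> smooth_on (\<lambda>x. c * f x) U"
  by (simp add: smooth_on_def Ck_on_cmult)

lemma smooth_on_uminus:
  "open U \<Longrightarrow> smooth_on f U \<Longrightarrow> smooth_on (\<lambda>x. - f x) U"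
  using smooth_on_cmult[of U f "-1"] by simp

lemma smooth_on_sum:
  assumes "open U" "\<And>i. i \<in> I \<Longrightarrow> smooth_on (f i) U"
  shows "smooth_on (\<lambda>x. \<Sum>i\<in>I. f i x) U"
  using assms(2)
  by (induction I rule: infinite_finite_induct)
    (auto simp: smooth_on_const intro: smooth_on_add[OF assms(1)])

lemma smooth_on_differentiable: "smooth_on f U \<Longrightarrow> x \<in> U \<Longrightarrow> f differentiable at x"
  by (metis Ck_on.simps(2) smooth_on_def)

lemma smooth_on_dd: "smooth_on f U \<Longrightarrow> smooth_on (dd v f) U"
  by (metis Ck_on.simps(2) smooth_on_def)

lemma smooth_on_continuous: "smooth_on f U \<Longrightarrow> continuous_on U f"
  by (metis Ck_on.simps(1) smooth_on_def)

section \<open>Symmetry of second derivatives\<close>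

lemma has_real_derivative_line:
  assumes "f differentiable at (x + s *\<^sub>R v)"
  shows "((\<lambda>s. f (x + s *\<^sub>R v)) has_real_derivative dd v f (x + s *\<^sub>R v)) (at s)"
proof -
  have "((f \<circ> (\<lambda>s. x + s *\<^sub>R v)) has_derivative (\<lambda>h. dd (h *\<^sub>R v) f (x + s *\<^sub>R v))) (at s)"
    unfolding o_def
    by (rule has_derivative_compose[where f = "\<lambda>s. x + s *\<^sub>R v" and g = f])
      (use assms frechet_derivative_works in \<open>auto intro!: derivative_eq_intros\<close>)
  then show ?thesis
    by (simp add: has_field_derivative_def o_def dd_linear[OF assms] mult_commute_abs)
qed

text \<open>The mean value theorem is applied twice: along \<open>v\<close> to the increment
  \<open>\<phi>\<close> in direction \<open>w\<close>, then along \<open>w\<close> to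
  \<open>dd v f\<close>. The second difference is symmetric in \<open>v\<close> and
  \<open>w\<close>, so exchanging the directions expresses it by the other mixed derivative.\<close>

lemma second_difference_mean_value:
  fixes f :: "'a::euclidean_space \<Rightarrow> real"
  assumes f: "smooth_on f U" and r: "ball x r \<subseteq> U"
    and t: "0 < t" "t * (norm v + norm w) < r"
  obtains z where "z \<in> ball x r"
    "f (x + t *\<^sub>R v + t *\<^sub>R w) - f (x + t *\<^sub>R v) - f (x + t *\<^sub>R w) + f x = t\<^sup>2 * dd w (dd v f) z"
proof -
  have ball: "x + a *\<^sub>R v + b *\<^sub>R w \<in> ball x r" if "0 \<le> a" "a \<le> t" "0 \<le> b" "b \<le> t" for a b
  proof -
    have "norm (a *\<^sub>R v + b *\<^sub>R w) \<le> a * norm v + b * norm w"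
      using that norm_triangle_ineq[of "a *\<^sub>R v" "b *\<^sub>R w"] by simp
    also have "\<dots> \<le> t * norm v + t * norm w"
      using that by (intro add_mono mult_right_mono) auto
    finally have "norm (a *\<^sub>R v + b *\<^sub>R w) < r"
      using t by (simp add: algebra_simps)
    then show ?thesis
      by (metis add.assoc add_diff_cancel_left' dist_commute dist_norm mem_ball)
  qed
  have diff: "f differentiable at (x + a *\<^sub>R v + b *\<^sub>R w)"
      "dd v f differentiable at (x + a *\<^sub>R v + b *\<^sub>R w)"
    if "0 \<le> a" "a \<le> t" "0 \<le> b" "b \<le> t" for a b
    using ball[OF that] r smooth_on_differentiable[OF f] smooth_on_differentiable[OF smooth_on_dd[OF f]]
    by blast+
  define \<phi> where "\<phi> s = f (x + t *\<^sub>R w + s *\<^sub>R v) - f (x + s *\<^sub>R v)" for s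
  have "(\<phi> has_real_derivative dd v f (x + t *\<^sub>R w + s *\<^sub>R v) - dd v f (x + s *\<^sub>R v)) (at s)"
    if "0 \<le> s" "s \<le> t" for s
    unfolding \<phi>_def
    using diff(1)[of s t] diff(1)[of s 0] that t
    by (intro DERIV_diff has_real_derivative_line) (simp_all add: add.assoc add.commute[of "t *\<^sub>R w"])
  from MVT2[OF t(1) this] obtain \<xi> where \<xi>: "0 < \<xi>" "\<xi> < t"
    and 1: "\<phi> t - \<phi> 0 = t * (dd v f (x + t *\<^sub>R w + \<xi> *\<^sub>R v) - dd v f (x + \<xi> *\<^sub>R v))"
    by auto
  have "((\<lambda>s. dd v f (x + \<xi> *\<^sub>R v + s *\<^sub>R w)) has_real_derivative
      dd w (dd v f) (x + \<xi> *\<^sub>R v + s *\<^sub>R w)) (at s)" if "0 \<le> s" "s \<le> t" for s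
    using diff(2)[of \<xi> s] that \<xi> by (intro has_real_derivative_line) auto
  from MVT2[OF t(1) this] obtain \<eta> where \<eta>: "0 < \<eta>" "\<eta> < t"
    and 2: "dd v f (x + \<xi> *\<^sub>R v + t *\<^sub>R w) - dd v f (x + \<xi> *\<^sub>R v)
      = t * dd w (dd v f) (x + \<xi> *\<^sub>R v + \<eta> *\<^sub>R w)"
    by auto
  show ?thesis
  proof (rule that)
    show "x + \<xi> *\<^sub>R v + \<eta> *\<^sub>R w \<in> ball x r"
      using ball \<xi> \<eta> by simp
    have swap: "x + t *\<^sub>R w + s *\<^sub>R v = x + s *\<^sub>R v + t *\<^sub>R w" for s
      by simp
    show "f (x + t *\<^sub>R v + t *\<^sub>R w) - f (x + t *\<^sub>R v) - f (x + t *\<^sub>R w) + f x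
        = t\<^sup>2 * dd w (dd v f) (x + \<xi> *\<^sub>R v + \<eta> *\<^sub>R w)"
      using 1[unfolded \<phi>_def swap 2] by (simp add: power2_eq_square algebra_simps)
  qed
qed

text \<open>Both mixed derivatives, each at some point near \<open>x\<close>, equal the same second
  difference divided by \<open>t\<^sup>2\<close>; continuity at \<open>x\<close> then forces
  equality.\<close>

lemma smooth_on_dd_commute:
  assumes U: "open U" "x \<in> U" and f: "smooth_on f U"
  shows "dd v (dd w f) x = dd w (dd v f) x"
proof (rule ccontr)
  let ?a = "dd v (dd w f)" and ?b = "dd w (dd v f)"
  define e where "e = \<bar>?a x - ?b x\<bar> / 2"
  assume "?a x \<noteq> ?b x"
  then have e: "e > 0" by (simp add: e_def)
  have cont: "\<exists>d>0. \<forall>y. dist y x < d \<longrightarrow> dist (dd v (dd w f) y) (dd v (dd w f) x) < e" for v w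
  proof -
    have "continuous (at x) (dd v (dd w f))"
      using U smooth_on_continuous[OF smooth_on_dd[OF smooth_on_dd[OF f]]]
      by (simp add: continuous_on_eq_continuous_at)
    then show ?thesis
      using e unfolding continuous_at_eps_delta by simp
  qed
  obtain r1 where r1: "r1 > 0" "\<And>y. dist y x < r1 \<Longrightarrow> dist (?a y) (?a x) < e"
    using cont by metis
  obtain r2 where r2: "r2 > 0" "\<And>y. dist y x < r2 \<Longrightarrow> dist (?b y) (?b x) < e"
    using cont by metis
  obtain r3 where r3: "r3 > 0" "ball x r3 \<subseteq> U"
    using U open_contains_ball by blast
  define r where "r = min r1 (min r2 r3)"
  have r: "r > 0" "ball x r \<subseteq> U"
    using r1 r2 r3 by (auto simp: r_def)
  \<comment> \<open>The summand 1 keeps the denominator positive when both directions vanish and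
    makes the bound by \<open>r\<close> strict.\<close>
  define t where "t = r / (norm v + norm w + 1)"
  have "norm v + norm w + 1 > 0"
    by (simp add: add_nonneg_pos)
  then have t: "0 < t" "t * (norm v + norm w) < r"
    using r by (simp_all add: t_def field_simps)
  from t(2) have t': "t * (norm w + norm v) < r"
    by (simp only: add.commute)
  obtain y where y: "y \<in> ball x r"
    "f (x + t *\<^sub>R v + t *\<^sub>R w) - f (x + t *\<^sub>R v) - f (x + t *\<^sub>R w) + f x = t\<^sup>2 * ?b y"
    using second_difference_mean_value[OF f r(2) t] .
  obtain z where z: "z \<in> ball x r"
    "f (x + t *\<^sub>R w + t *\<^sub>R v) - f (x + t *\<^sub>R w) - f (x + t *\<^sub>R v) + f x = t\<^sup>2 * ?a z"
    using second_difference_mean_value[OF f r(2) t(1) t'] .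
  have swap: "x + t *\<^sub>R w + t *\<^sub>R v = x + t *\<^sub>R v + t *\<^sub>R w"
    by simp
  have "t\<^sup>2 * ?b y = t\<^sup>2 * ?a z"
    using y(2) z(2)[unfolded swap] by linarith
  then have "?b y = ?a z" using t by simp
  moreover have "dist y x < r" "dist z x < r"
    using y(1) z(1) by (simp_all add: dist_commute)
  then have "dist (?a z) (?a x) < e" "dist (?b y) (?b x) < e"
    using r1(2)[of z] r2(2)[of y] by (simp_all add: r_def)
  moreover have "2 * e = dist (?a x) (?b x)"
    by (simp add: e_def dist_real_def)
  ultimately show False
    using dist_triangle[of "?a x" "?b x" "?a z"] by (simp add: dist_commute)
qed

section \<open>The inward normal and functions vanishing on the boundary\<close>

lemma has_derivative_pos_direction:
  fixes f :: "'a::euclidean_space \<Rightarrow> real"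
  assumes f: "(f has_derivative L) (at x)" and "f x = 0" and "L v > 0"
  shows "eventually (\<lambda>t. f (x + t *\<^sub>R v) > 0) (at_right 0)"
proof -
  interpret L: bounded_linear L
    using f by (rule has_derivative_bounded_linear)
  have "((f \<circ> (\<lambda>t. x + t *\<^sub>R v)) has_derivative (\<lambda>t. L (t *\<^sub>R v))) (at 0)"
    unfolding o_def
    by (rule has_derivative_compose[where f = "\<lambda>s. x + s *\<^sub>R v" and g = f])
      (use f in \<open>auto intro!: derivative_eq_intros\<close>)
  then have "DERIV (\<lambda>t. f (x + t *\<^sub>R v)) 0 :> L v"
    by (simp add: has_field_derivative_def o_def L.scaleR mult_commute_abs)
  from DERIV_pos_inc_right[OF this assms(3)] obtain d where
    "d > 0" "\<forall>h>0. h < d \<longrightarrow> f x < f (x + h *\<^sub>R v)"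
    by auto
  then show ?thesis
    using assms(2) by (auto simp: eventually_at_right_field)
qed

text \<open>Along a ray from \<open>x\<close> the defining function starts at 0 with slope
  \<open>g \<bullet> v\<close>, so the sign of the slope decides membership in \<open>M\<close> at
  small positive times.\<close>

lemma local_defining_function_sign:
  assumes \<rho>: "local_defining_function M x U \<rho>" "GDERIV \<rho> x :> g"
    and M: "closed M" "x \<in> frontier M"
  shows "g \<bullet> v > 0 \<Longrightarrow> eventually (\<lambda>t. x + t *\<^sub>R v \<in> M) (at_right 0)"
    and "g \<bullet> v < 0 \<Longrightarrow> eventually (\<lambda>t. x + t *\<^sub>R v \<notin> M) (at_right 0)"
proof -
  have U: "open U" "x \<in> U" and MU: "\<And>y. y \<in> U \<Longrightarrow> y \<in> M \<longleftrightarrow> \<rho> y \<ge> 0"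
    using \<rho> by (auto simp: local_defining_function_def)
  have der: "(\<rho> has_derivative (\<lambda>h. h \<bullet> g)) (at x)"
    using \<rho>(2) by (simp add: gderiv_def)
  have xM: "x \<in> M"
    using M frontier_subset_closed by blast
  \<comment> \<open>A positive value would persist nearby and make \<open>x\<close> an interior
    point of \<open>M\<close>.\<close>
  have "\<rho> x = 0"
  proof (rule ccontr)
    assume "\<rho> x \<noteq> 0"
    moreover have "\<rho> x \<ge> 0"
      using MU xM U by auto
    ultimately have "\<rho> x > 0" by simp
    moreover have "isCont \<rho> x"
      using der has_derivative_continuous by blast
    ultimately have "\<forall>\<^sub>F y in at x. \<rho> y > 0"
      unfolding isCont_def by (rule order_tendstoD(1)[rotated])
    moreover have "\<forall>\<^sub>F y in at x. y \<in> U"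
      using U by (rule eventually_at_in_open')
    ultimately have "\<forall>\<^sub>F y in at x. y \<in> M"
      by eventually_elim (use MU in auto)
    then have "\<forall>\<^sub>F y in nhds x. y \<in> M"
      using xM by (simp add: eventually_nhds_conv_at)
    then have "x \<in> interior M"
      unfolding eventually_nhds by (auto intro: interiorI)
    then show False
      using M by (simp add: frontier_def)
  qed
  have inU: "eventually (\<lambda>t. x + t *\<^sub>R v \<in> U) (at_right 0)" for v
  proof -
    have "((\<lambda>t. x + t *\<^sub>R v) \<longlongrightarrow> x + 0 *\<^sub>R v) (at_right 0)"
      by (intro tendsto_intros)
    then show ?thesis
      using U topological_tendstoD by fastforce
  qed
  show "eventually (\<lambda>t. x + t *\<^sub>R v \<in> M) (at_right 0)" if "g \<bullet> v > 0"
  proof -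
    have "eventually (\<lambda>t. \<rho> (x + t *\<^sub>R v) > 0) (at_right 0)"
      using that \<open>\<rho> x = 0\<close> by (intro has_derivative_pos_direction[OF der]) (auto simp: inner_commute)
    with inU[of v] show ?thesis
      by eventually_elim (use MU in auto)
  qed
  show "eventually (\<lambda>t. x + t *\<^sub>R v \<notin> M) (at_right 0)" if "g \<bullet> v < 0"
  proof -
    have "eventually (\<lambda>t. - \<rho> (x + t *\<^sub>R v) > 0) (at_right 0)"
      using that \<open>\<rho> x = 0\<close>
      by (intro has_derivative_pos_direction[OF has_derivative_minus[OF der]]) (auto simp: inner_commute)
    with inU[of v] show ?thesis
      by eventually_elim (use MU in auto)
  qed
qed

text \<open>This makes the definite description usable. Existence comes from normalising the
  gradient of any defining function. If two candidates differed, their difference would point into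
  \<open>M\<close> by one defining function and out of \<open>M\<close> by the other.\<close>

lemma inward_unit_normal:
  fixes M :: "'a::euclidean_space set"
  assumes M: "smooth_boundary M" "closed M" "x \<in> frontier M"
  obtains U \<rho> c where "norm (inward_unit_normal M x) = 1" "local_defining_function M x U \<rho>"
    "c > 0" "GDERIV \<rho> x :> c *\<^sub>R inward_unit_normal M x"
proof -
  define P where "P \<nu> \<longleftrightarrow> norm \<nu> = 1 \<and>
     (\<exists>U \<rho> c. local_defining_function M x U \<rho> \<and> c > 0 \<and> GDERIV \<rho> x :> c *\<^sub>R \<nu>)" for \<nu> :: 'a
  obtain U \<rho> where U: "local_defining_function M x U \<rho>"
    using M by (auto simp: smooth_boundary_def)
  then have "x \<in> U" "smooth_on \<rho> U"
    by (auto simp: local_defining_function_def)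
  then have "\<rho> differentiable at x"
    using smooth_on_differentiable by blast
  then obtain g where g: "GDERIV \<rho> x :> g"
  proof -
    assume *: "\<And>g. GDERIV \<rho> x :> g \<Longrightarrow> thesis"
    define L where "L = frechet_derivative \<rho> (at x)"
    have L: "(\<rho> has_derivative L) (at x)"
      using \<open>\<rho> differentiable at x\<close> frechet_derivative_works L_def by blast
    \<comment> \<open>Riesz representation: the gradient is the adjoint of the derivative applied to
      1.\<close>
    have "L = (\<lambda>h. h \<bullet> adjoint L 1)"
      using adjoint_works[OF has_derivative_linear[OF L], of _ 1] by (simp add: fun_eq_iff)
    with L show thesis
      using *[of "adjoint L 1"] by (simp add: gderiv_def)
  qed
  have "g \<noteq> 0"
    using U g \<open>x \<in> U\<close> by (auto simp: local_defining_function_def)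
  then have "P (sgn g)"
    unfolding P_def using U g
    by (auto simp: norm_sgn intro!: exI[of _ U] exI[of _ \<rho>] exI[of _ "norm g"])
      (simp add: sgn_div_norm)
  moreover have "\<mu> = \<nu>" if P: "P \<mu>" "P \<nu>" for \<mu> \<nu>
  proof (rule ccontr)
    assume "\<mu> \<noteq> \<nu>"
    obtain U1 \<rho>1 c1 where 1: "local_defining_function M x U1 \<rho>1" "c1 > 0" "GDERIV \<rho>1 x :> c1 *\<^sub>R \<mu>"
      using P by (auto simp: P_def)
    obtain U2 \<rho>2 c2 where 2: "local_defining_function M x U2 \<rho>2" "c2 > 0" "GDERIV \<rho>2 x :> c2 *\<^sub>R \<nu>"
      using P by (auto simp: P_def)
    have n: "\<mu> \<bullet> \<mu> = 1" "\<nu> \<bullet> \<nu> = 1"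
      using P by (auto simp: P_def norm_eq_1)
    \<comment> \<open>Strict Cauchy-Schwarz for distinct unit vectors; it fixes the sign of both
      slopes along \<open>\<mu> - \<nu>\<close>.\<close>
    have "(\<mu> - \<nu>) \<bullet> (\<mu> - \<nu>) > 0"
      using \<open>\<mu> \<noteq> \<nu>\<close> by simp
    then have lt: "\<mu> \<bullet> \<nu> < 1"
      using n by (simp add: inner_diff inner_commute)
    have "(c1 *\<^sub>R \<mu>) \<bullet> (\<mu> - \<nu>) > 0"
      using lt n 1(2) by (simp add: inner_diff_right)
    from local_defining_function_sign(1)[OF 1(1,3) M(2,3) this]
    have a: "eventually (\<lambda>t. x + t *\<^sub>R (\<mu> - \<nu>) \<in> M) (at_right 0)" .
    have "(c2 *\<^sub>R \<nu>) \<bullet> (\<mu> - \<nu>) < 0"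
      using lt n 2(2) by (simp add: inner_diff_right inner_commute mult_less_0_iff)
    from local_defining_function_sign(2)[OF 2(1,3) M(2,3) this]
    have "eventually (\<lambda>t. x + t *\<^sub>R (\<mu> - \<nu>) \<notin> M) (at_right 0)" .
    with a have "eventually (\<lambda>t::real. False) (at_right 0)"
      by eventually_elim blast
    then show False
      by (simp add: trivial_limit_at_right_real)
  qed
  ultimately have "P (inward_unit_normal M x)"
    unfolding inward_unit_normal_def P_def[symmetric] by (metis theI')
  then show thesis
    using that by (auto simp: P_def)
qed

text \<open>The segment between \<open>x + t(v - e\<nu>)\<close> and \<open>x + t(v + e\<nu>)\<close> joins the complement of \<open>M\<close> to
  \<open>M\<close> for small \<open>t > 0\<close>, so it meets the boundary. This yields zeros of \<open>f\<close> arbitrarily close to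
  \<open>x\<close> in directions arbitrarily close to \<open>v\<close>, without the implicit function theorem.\<close>

lemma tangential_derivative_zero:
  fixes M :: "'a::euclidean_space set"
  assumes M: "smooth_boundary M" "closed M" "x \<in> frontier M"
    and f: "f differentiable at x" "\<And>y. y \<in> frontier M \<Longrightarrow> f y = 0"
    and v: "v \<in> boundary_tangent_space M x"
  shows "dd v f x = 0"
proof (rule ccontr)
  assume neq: "dd v f x \<noteq> 0"
  define \<nu> where "\<nu> = inward_unit_normal M x"
  obtain U \<rho> c where \<nu>: "norm \<nu> = 1" and \<rho>: "local_defining_function M x U \<rho>"
    and c: "c > 0" "GDERIV \<rho> x :> c *\<^sub>R \<nu>"
    using inward_unit_normal[OF M] unfolding \<nu>_def .
  have \<nu>1: "\<nu> \<bullet> \<nu> = 1" using \<nu> by (simp add: norm_eq_1)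
  have v\<nu>: "\<nu> \<bullet> v = 0"
    using v by (simp add: boundary_tangent_space_def \<nu>_def inner_commute)
  define L where "L = frechet_derivative f (at x)"
  have L: "(f has_derivative L) (at x)"
    using f(1) frechet_derivative_works L_def by blast
  interpret L: bounded_linear L
    using L by (rule has_derivative_bounded_linear)
  define m where "m = \<bar>L v\<bar>"
  have m: "m > 0" using neq by (simp add: m_def L_def)
  \<comment> \<open>The gap \<open>m\<close> is split in two. A tilt by at most \<open>e\<close> in
    the normal direction changes \<open>L v\<close> by less than \<open>m / 2\<close>, and the
    differentiability error with slope \<open>e'\<close> is at most \<open>m / 2\<close> on vectors
    of norm at most \<open>norm v + e\<close>. The summand 1 covers
    \<open>L \<nu> = 0\<close>.\<close>
  define e where "e = m / (2 * (\<bar>L \<nu>\<bar> + 1))"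
  have e: "e > 0" "e * \<bar>L \<nu>\<bar> < m / 2"
    using m by (auto simp: e_def field_simps)
  define e' where "e' = m / (2 * (norm v + e))"
  have ve: "norm v + e > 0" using e by (simp add: add_nonneg_pos)
  have e': "e' > 0" "e' * (norm v + e) = m / 2"
    using m ve by (auto simp: e'_def field_simps)
  obtain d where d: "d > 0"
    "\<And>y. norm (y - x) < d \<Longrightarrow> norm (f y - f x - L (y - x)) \<le> e' * norm (y - x)"
    using L e' unfolding has_derivative_at_alt by meson
  have "eventually (\<lambda>t. x + t *\<^sub>R (v + e *\<^sub>R \<nu>) \<in> M) (at_right 0)"
    using c e \<nu>1 v\<nu> by (intro local_defining_function_sign(1)[OF \<rho> c(2) M(2,3)]) (simp add: inner_right_distrib)
  moreover have "eventually (\<lambda>t. x + t *\<^sub>R (v - e *\<^sub>R \<nu>) \<notin> M) (at_right 0)"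
    using c e \<nu>1 v\<nu> by (intro local_defining_function_sign(2)[OF \<rho> c(2) M(2,3)]) (simp add: inner_diff_right)
  \<comment> \<open>This bound on \<open>t\<close> keeps the whole segment within distance
    \<open>d\<close> of \<open>x\<close>, where the error estimate holds.\<close>
  moreover have "eventually (\<lambda>t. t \<in> {0<..<d / (norm v + e)}) (at_right (0::real))"
    using d ve by (intro eventually_at_right_real) simp
  ultimately have "eventually (\<lambda>t. x + t *\<^sub>R (v + e *\<^sub>R \<nu>) \<in> M \<and> x + t *\<^sub>R (v - e *\<^sub>R \<nu>) \<notin> M \<and>
      0 < t \<and> t < d / (norm v + e)) (at_right 0)"
    by eventually_elim auto
  then obtain t where t: "x + t *\<^sub>R (v + e *\<^sub>R \<nu>) \<in> M" "x + t *\<^sub>R (v - e *\<^sub>R \<nu>) \<notin> M"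
      "0 < t" "t < d / (norm v + e)"
    using eventually_happens' trivial_limit_at_right_real by blast
  let ?S = "(\<lambda>s. x + t *\<^sub>R (v + s *\<^sub>R \<nu>)) ` {-e..e}"
  have "connected ?S"
    by (intro connected_continuous_image continuous_intros) auto
  moreover have "x + t *\<^sub>R (v + e *\<^sub>R \<nu>) \<in> ?S \<inter> M"
    using t e by auto
  moreover have "x + t *\<^sub>R (v - e *\<^sub>R \<nu>) \<in> ?S - M"
    using t e by (auto intro!: image_eqI[of _ _ "-e"])
  ultimately have "?S \<inter> frontier M \<noteq> {}"
    by (intro connected_Int_frontier) blast+
  then obtain s where "- e \<le> s" "s \<le> e" "x + t *\<^sub>R (v + s *\<^sub>R \<nu>) \<in> frontier M"
    by auto
  then have s: "\<bar>s\<bar> \<le> e" "x + t *\<^sub>R (v + s *\<^sub>R \<nu>) \<in> frontier M"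
    by simp_all
  let ?h = "v + s *\<^sub>R \<nu>"
  have nh: "norm ?h \<le> norm v + e"
    using norm_triangle_ineq[of v "s *\<^sub>R \<nu>"] s \<nu> by simp
  have "t * norm ?h \<le> t * (norm v + e)"
    using nh t by simp
  also have "\<dots> < d"
    using t ve by (simp add: field_simps)
  finally have "norm (t *\<^sub>R ?h) < d"
    using t by simp
  then have "norm (f (x + t *\<^sub>R ?h) - f x - L (t *\<^sub>R ?h)) \<le> e' * norm (t *\<^sub>R ?h)"
    using d(2)[of "x + t *\<^sub>R ?h"] by simp
  \<comment> \<open>Both \<open>x\<close> and the point found on the segment lie on the boundary, so
    the values of \<open>f\<close> drop out and only \<open>L\<close> remains.\<close>
  then have "t * \<bar>L ?h\<bar> \<le> t * (e' * norm ?h)"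
    using t f(2) s M by (simp add: L.scaleR abs_mult mult.left_commute)
  then have "\<bar>L ?h\<bar> \<le> e' * norm ?h"
    using t by simp
  also have "\<dots> \<le> m / 2"
    using mult_left_mono[OF nh, of e'] e' by simp
  finally have "\<bar>L v + s * L \<nu>\<bar> \<le> m / 2"
    by (simp add: L.add L.scaleR)
  moreover have "\<bar>s * L \<nu>\<bar> \<le> e * \<bar>L \<nu>\<bar>"
    using s by (simp add: abs_mult mult_right_mono)
  ultimately show False
    using e m unfolding m_def by linarith
qed

text \<open>The gradient is normal: \<open>v\<close> minus its normal part is tangential and
  contributes nothing.\<close>

lemma boundary_derivative:
  fixes M :: "'a::euclidean_space set"
  assumes M: "smooth_boundary M" "closed M" "x \<in> frontier M"
    and f: "f differentiable at x" "\<And>y. y \<in> frontier M \<Longrightarrow> f y = 0"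
  shows "dd v f x = (v \<bullet> inward_unit_normal M x) * dd (inward_unit_normal M x) f x"
proof -
  let ?\<nu> = "inward_unit_normal M x"
  have "norm ?\<nu> = 1"
    using inward_unit_normal[OF M] .
  then have "v - (v \<bullet> ?\<nu>) *\<^sub>R ?\<nu> \<in> boundary_tangent_space M x"
    by (simp add: boundary_tangent_space_def inner_diff_left norm_eq_1)
  from tangential_derivative_zero[OF M f this] have "dd (v - (v \<bullet> ?\<nu>) *\<^sub>R ?\<nu>) f x = 0" .
  moreover have "dd (v - (v \<bullet> ?\<nu>) *\<^sub>R ?\<nu>) f x + dd ((v \<bullet> ?\<nu>) *\<^sub>R ?\<nu>) f x = dd v f x"
    by (simp flip: dd_linear(1)[OF f(1)])
  ultimately show ?thesis
    by (simp add: dd_linear[OF f(1)])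
qed

section \<open>Alternating covectors\<close>

text \<open>Lists of the wrong length evaluate to 0, so slotwise linearity can be used without
  tracking the degree.\<close>

lemma alternating_covector_linear:
  assumes "alternating_covector p \<beta>" "i < length vs"
  shows "linear (\<lambda>v. \<beta> (vs[i := v]))"
proof (cases "length vs = p")
  case False
  then have "(\<lambda>v. \<beta> (vs[i := v])) = (\<lambda>v. 0)"
    using assms by (simp add: alternating_covector_def fun_eq_iff)
  then show ?thesis
    by (simp add: linear_zero)
qed (use assms in \<open>simp add: alternating_covector_def\<close>)

lemma alternating_covector_linear_Cons:
  assumes "alternating_covector p \<beta>"
  shows "linear (\<lambda>v. \<beta> (v # vs))"
  using alternating_covector_linear[OF assms, of 0 "undefined # vs"] by simp

lemma alternating_covector_not_distinct:
  assumes "alternating_covector p \<beta>" "\<not> distinct vs"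
  shows "\<beta> vs = 0"
  using assms by (cases "length vs = p") (auto simp: alternating_covector_def)

text \<open>Polarisation: the values with \<open>v + w\<close>, \<open>v\<close> or \<open>w\<close>
  in both slots are 0, so the two mixed terms cancel.\<close>

lemma alternating_covector_swap:
  assumes \<beta>: "alternating_covector p \<beta>" and i: "i < length vs" "j < length vs" "i \<noteq> j"
  shows "\<beta> (vs[i := v, j := w]) = - \<beta> (vs[i := w, j := v])"
proof -
  have lin1: "\<beta> (vs[i := a + b, j := c]) = \<beta> (vs[i := a, j := c]) + \<beta> (vs[i := b, j := c])" for a b c
    using linear_add[OF alternating_covector_linear[OF \<beta>, of i "vs[j := c]"], of a b] i
    by (simp add: list_update_swap)
  have lin2: "\<beta> (vs[i := a, j := b + c]) = \<beta> (vs[i := a, j := b]) + \<beta> (vs[i := a, j := c])" for a b c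
    using linear_add[OF alternating_covector_linear[OF \<beta>, of j "vs[i := a]"], of b c] i by simp
  have rep: "\<beta> (vs[i := a, j := a]) = 0" for a
  proof (rule alternating_covector_not_distinct[OF \<beta>])
    have "vs[i := a, j := a] ! i = vs[i := a, j := a] ! j"
      using i by simp
    then show "\<not> distinct (vs[i := a, j := a])"
      using i nth_eq_iff_index_eq by fastforce
  qed
  show ?thesis
    using lin1[of v w "v + w"] lin2[of v v w] lin2[of w v w] rep[of v] rep[of w] rep[of "v + w"]
    by linarith
qed

text \<open>Projecting an argument changes it by a multiple of \<open>\<nu>\<close>, which
  \<open>\<gamma>\<close> kills. The function \<open>\<gamma>\<close> is kept general so that it may
  be a covector whose first slot is already filled by \<open>\<nu>\<close>.\<close>

lemma multilinear_project:
  fixes \<nu> :: "'a::real_vector"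
  assumes lin: "\<And>vs i. length vs = m \<Longrightarrow> i < m \<Longrightarrow> linear (\<lambda>v. \<gamma> (vs[i := v]) :: real)"
    and zero: "\<And>vs. length vs = m \<Longrightarrow> \<nu> \<in> set vs \<Longrightarrow> \<gamma> vs = 0"
    and \<pi>: "\<And>v. v = c v *\<^sub>R \<nu> + \<pi> v"
    and "length vs = m"
  shows "\<gamma> vs = \<gamma> (map \<pi> vs)"
proof -
  \<comment> \<open>Interpolates between the two sides: the first \<open>k\<close> arguments are
    projected, the rest are untouched.\<close>
  have "\<gamma> vs = \<gamma> (map \<pi> (take k vs) @ drop k vs)" if "k \<le> m" for k
    using that
  proof (induction k)
    case 0
    then show ?case by simp
  next
    case (Suc k)
    define us where "us = map \<pi> (take k vs) @ drop k vs"
    define v where "v = vs ! k"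
    have us: "length us = m" "k < length us" "us ! k = v"
      using Suc.prems assms(4) by (auto simp: us_def v_def nth_append)
    have next_eq: "us[k := \<pi> v] = map \<pi> (take (Suc k) vs) @ drop (Suc k) vs"
      using Suc.prems assms(4)
      by (simp add: us_def v_def list_update_append take_Suc_conv_app_nth Cons_nth_drop_Suc[symmetric])
    have "\<gamma> vs = \<gamma> (us[k := v])"
      using Suc us by (metis Suc_leD list_update_id us_def)
    also have "\<dots> = \<gamma> (us[k := c v *\<^sub>R \<nu> + \<pi> v])"
      using \<pi>[of v] by simp
    also have "\<dots> = c v * \<gamma> (us[k := \<nu>]) + \<gamma> (us[k := \<pi> v])"
      using us linear_add[OF lin[of us k], of "c v *\<^sub>R \<nu>" "\<pi> v"] linear_cmul[OF lin[of us k], of "c v" \<nu>]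
      by simp
    also have "\<gamma> (us[k := \<nu>]) = 0"
      using us by (intro zero) (auto intro: set_update_memI)
    finally show ?case
      by (simp add: next_eq)
  qed
  from this[of m] show ?thesis
    using assms(4) by simp
qed

text \<open>With \<open>\<nu>\<close> in front, a second \<open>\<nu>\<close> gives 0, so the other
  arguments may be projected and \<open>nor\<close> applies. A \<open>\<nu>\<close> elsewhere is
  swapped to the front. Hence \<open>\<beta>\<close> vanishes on every list containing
  \<open>\<nu>\<close>, so all arguments of any list may be projected and \<open>tan\<close>
  applies.\<close>

lemma alternating_covector_eq_0I:
  fixes \<nu> :: "'a::euclidean_space"
  assumes \<beta>: "alternating_covector p \<beta>" and \<nu>: "norm \<nu> = 1"
    and tan: "\<And>vs. vs \<in> lists {v. v \<bullet> \<nu> = 0} \<Longrightarrow> \<beta> vs = 0"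
    and nor: "\<And>vs. vs \<in> lists {v. v \<bullet> \<nu> = 0} \<Longrightarrow> \<beta> (\<nu> # vs) = 0"
  shows "\<beta> vs = 0"
proof -
  define \<pi> where "\<pi> v = v - (v \<bullet> \<nu>) *\<^sub>R \<nu>" for v
  have \<pi>: "v = (v \<bullet> \<nu>) *\<^sub>R \<nu> + \<pi> v" for v
    by (simp add: \<pi>_def)
  have "\<pi> v \<bullet> \<nu> = 0" for v
    using \<nu> by (simp add: \<pi>_def inner_diff_left norm_eq_1)
  then have \<pi>_tan: "map \<pi> us \<in> lists {v. v \<bullet> \<nu> = 0}" for us
    by auto
  have front: "\<beta> (\<nu> # us) = 0" for us
  proof -
    have "\<beta> (\<nu> # us) = \<beta> (\<nu> # map \<pi> us)"
    proof (rule multilinear_project[where m = "length us" and \<nu> = \<nu> and c = "\<lambda>v. v \<bullet> \<nu>"])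
      show "linear (\<lambda>v. \<beta> (\<nu> # ws[i := v]))" if "length ws = length us" "i < length us" for ws i
        using alternating_covector_linear[OF \<beta>, of "Suc i" "\<nu> # ws"] that by simp
      show "\<beta> (\<nu> # ws) = 0" if "\<nu> \<in> set ws" for ws
        using that by (intro alternating_covector_not_distinct[OF \<beta>]) simp
    qed (use \<pi> in auto)
    then show ?thesis
      using nor[OF \<pi>_tan] by simp
  qed
  have mem: "\<beta> us = 0" if "\<nu> \<in> set us" for us
  proof -
    obtain i where i: "i < length us" "us ! i = \<nu>"
      using \<open>\<nu> \<in> set us\<close> by (auto simp: in_set_conv_nth)
    show ?thesis
    proof (cases i)
      case 0
      then show ?thesis
        using front i by (cases us) auto
    next
      case (Suc j)
      have "\<beta> us = \<beta> (us[0 := us ! 0, i := \<nu>])"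
        using i by (metis list_update_id)
      also have "\<dots> = - \<beta> (us[0 := \<nu>, i := us ! 0])"
        using i Suc by (intro alternating_covector_swap[OF \<beta>]) auto
      also have "us[0 := \<nu>, i := us ! 0] = \<nu> # tl (us[0 := \<nu>, i := us ! 0])"
        using i Suc by (cases us) auto
      finally show ?thesis
        by (simp add: front)
    qed
  qed
  have "\<beta> vs = \<beta> (map \<pi> vs)"
    by (rule multilinear_project[where m = "length vs" and \<nu> = \<nu> and c = "\<lambda>v. v \<bullet> \<nu>"])
      (use alternating_covector_linear[OF \<beta>] mem \<pi> in auto)
  then show ?thesis
    using tan[OF \<pi>_tan] by simp
qed

text \<open>The covector is the determinant of the identity matrix with \<open>p\<close> rows
  replaced by the arguments; \<open>p \<le> CARD('n)\<close> provides enough rows. For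
  \<open>p = 0\<close> it takes the value 1 on the empty list.\<close>

lemma exists_alternating_covector:
  assumes "p \<le> CARD('n::finite)"
  obtains \<alpha> :: "(real ^ 'n) covector" and vs where "alternating_covector p \<alpha>" "\<alpha> vs \<noteq> 0"
proof -
  obtain h :: "'n \<Rightarrow> nat" where h: "bij_betw h UNIV {0..<CARD('n)}"
    using ex_bij_betw_finite_nat[of "UNIV :: 'n set"] by auto
  then have inj: "h i = h j \<longleftrightarrow> i = j" for i j
    by (auto simp: bij_betw_def inj_on_def)
  \<comment> \<open>\<open>h\<close> numbers the coordinates from 0 and \<open>k\<close> inverts it,
    so argument \<open>i\<close> fills row \<open>k i\<close>.\<close>
  define k where "k = inv_into UNIV h"
  have hk: "h (k i) = i" if "i < p" for i
    using h that assms by (auto simp: k_def bij_betw_def intro!: f_inv_into_f)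
  define A :: "(real ^ 'n) list \<Rightarrow> real ^ 'n ^ 'n"
    where "A vs = (\<chi> i. if h i < p then vs ! h i else axis i 1)" for vs
  define \<alpha> where "\<alpha> vs = (if length vs = p then det (A vs) else 0)" for vs
  have "alternating_covector p \<alpha>"
    unfolding alternating_covector_def
  proof (intro conjI allI impI)
    fix vs :: "(real ^ 'n) list" and i
    assume vs: "length vs = p" and i: "i < p"
    have A_upd: "A (vs[i := v]) = (\<chi> j. if j = k i then v else A vs $ j)" for v
      using vs i hk[OF i] inj by (auto simp: A_def vec_eq_iff nth_list_update)
    show "linear (\<lambda>v. \<alpha> (vs[i := v]))"
    proof (rule linearI)
      show "\<alpha> (vs[i := v + w]) = \<alpha> (vs[i := v]) + \<alpha> (vs[i := w])" for v w
        using vs by (simp add: \<alpha>_def A_upd det_row_add)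
      show "\<alpha> (vs[i := c *\<^sub>R v]) = c *\<^sub>R \<alpha> (vs[i := v])" for c v
        using vs by (simp add: \<alpha>_def A_upd det_row_mul flip: scalar_mult_eq_scaleR)
    qed
  next
    fix vs :: "(real ^ 'n) list"
    assume vs: "length vs = p" "\<not> distinct vs"
    then obtain i j where ij: "i < p" "j < p" "i \<noteq> j" "vs ! i = vs ! j"
      by (auto simp: distinct_conv_nth)
    then have "k i \<noteq> k j" "row (k i) (A vs) = row (k j) (A vs)"
      using hk by (metis, simp add: row_def A_def)
    then show "\<alpha> vs = 0"
      using vs det_identical_rows by (simp add: \<alpha>_def)
  qed (simp add: \<alpha>_def)
  \<comment> \<open>Inserting the unit vectors that were replaced restores the identity
    matrix.\<close>
  moreover have "\<alpha> (map (\<lambda>i. axis (k i) 1) [0..<p]) \<noteq> 0"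
  proof -
    have "k (h i) = i" for i
      using h by (simp add: k_def bij_betw_def)
    then have "A (map (\<lambda>i. axis (k i) 1) [0..<p]) = mat 1"
      by (auto simp: A_def vec_eq_iff mat_def axis_def)
    then show ?thesis
      by (simp add: \<alpha>_def)
  qed
  ultimately show thesis
    using that by blast
qed

section \<open>The form problem in components\<close>

lemma smooth_on_laplacian:
  "open U \<Longrightarrow> smooth_on f U \<Longrightarrow> smooth_on (laplacian f) U"
  unfolding laplacian_def by (intro smooth_on_uminus smooth_on_sum smooth_on_dd)

lemma laplacian_cong:
  assumes "open U" "smooth_on f U" "\<And>y. y \<in> U \<Longrightarrow> f y = g y" "x \<in> U"
  shows "laplacian f x = laplacian g x"
proof -
  have "dd e (dd e f) x = dd e (dd e g) x" for e
  proof (rule dd_cong[OF _ assms(1,4)])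
    show "dd e f differentiable at x"
      using assms by (blast intro: smooth_on_differentiable smooth_on_dd)
    show "dd e f y = dd e g y" if "y \<in> U" for y
      using that assms by (intro dd_cong[of _ _ U]) (auto intro: smooth_on_differentiable)
  qed
  then show ?thesis
    by (simp add: laplacian_def)
qed

lemma laplacian_add:
  assumes "open U" "smooth_on f U" "smooth_on g U" "x \<in> U"
  shows "laplacian (\<lambda>y. f y + g y) x = laplacian f x + laplacian g x"
proof -
  have "dd e (dd e (\<lambda>y. f y + g y)) x = dd e (dd e f) x + dd e (dd e g) x" for e
  proof -
    have "dd e (dd e (\<lambda>y. f y + g y)) x = dd e (\<lambda>y. dd e f y + dd e g y) x"
      using assms
      by (intro dd_cong[of _ _ U])
        (auto intro!: dd_add smooth_on_differentiable[of _ U] smooth_on_dd smooth_on_add)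
    also have "\<dots> = dd e (dd e f) x + dd e (dd e g) x"
      using assms by (intro dd_add smooth_on_differentiable[of _ U] smooth_on_dd)
    finally show ?thesis .
  qed
  then show ?thesis
    by (simp add: laplacian_def sum.distrib)
qed

lemma laplacian_cmult:
  assumes "open U" "smooth_on f U" "x \<in> U"
  shows "laplacian (\<lambda>y. c * f y) x = c * laplacian f x"
proof -
  have "dd e (dd e (\<lambda>y. c * f y)) x = c * dd e (dd e f) x" for e
  proof -
    have "dd e (dd e (\<lambda>y. c * f y)) x = dd e (\<lambda>y. c * dd e f y) x"
      using assms
      by (intro dd_cong[of _ _ U])
        (auto intro!: dd_cmult smooth_on_differentiable[of _ U] smooth_on_dd smooth_on_cmult)
    also have "\<dots> = c * dd e (dd e f) x"
      using assms by (intro dd_cmult smooth_on_differentiable[of _ U] smooth_on_dd)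
    finally show ?thesis .
  qed
  then show ?thesis
    by (simp add: laplacian_def sum_distrib_left)
qed

text \<open>Cartan's formula for a constant field \<open>v\<close>: the subtracted sum is the
  exterior derivative of the contraction of \<open>\<omega>\<close> with \<open>v\<close>, its sign
  coming from the index shift.\<close>

lemma exterior_derivative_Cons:
  "exterior_derivative \<omega> x (v # vs) = dd v (\<lambda>y. \<omega> y vs) x
     - (\<Sum>i<length vs. (-1) ^ i * dd (vs ! i) (\<lambda>y. \<omega> y (v # take i vs @ drop (Suc i) vs)) x)"
  by (simp add: exterior_derivative_def sum.lessThan_Suc_shift sum_negf del: sum.lessThan_Suc)

text \<open>The mixed terms of \<open>d\<delta>\<close> and \<open>\<delta>d\<close> cancel by the symmetry of second derivatives.\<close>

lemma hodge_laplacian_components: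
  assumes U: "open U" "x \<in> U" and \<omega>: "\<And>vs. smooth_on (\<lambda>y. \<omega> y vs) U"
  shows "hodge_laplacian \<omega> x vs = laplacian (\<lambda>y. \<omega> y vs) x"
proof -
  \<comment> \<open>The component with \<open>e\<close> in front and argument \<open>i\<close>
    omitted; the mixed terms of both compositions are second derivatives of these
    components.\<close>
  define g where "g e i = (\<lambda>y. \<omega> y (e # take i vs @ drop (Suc i) vs))" for e i
  have g: "smooth_on (g e i) U" for e i
    unfolding g_def by (rule \<omega>)
  have diff: "f differentiable at x" if "smooth_on f U" for f
    using smooth_on_differentiable[OF that U(2)] .
  have "exterior_derivative (codifferential \<omega>) x vs =
      (\<Sum>i<length vs. (-1) ^ i * dd (vs ! i) (\<lambda>y. - (\<Sum>e\<in>Basis. dd e (g e i) y)) x)"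
    by (simp add: exterior_derivative_def codifferential_def g_def)
  also have "\<dots> = - (\<Sum>i<length vs. \<Sum>e\<in>Basis. (-1) ^ i * dd (vs ! i) (dd e (g e i)) x)"
  proof -
    have "dd (vs ! i) (\<lambda>y. - (\<Sum>e\<in>Basis. dd e (g e i) y)) x
        = - (\<Sum>e\<in>Basis. dd (vs ! i) (dd e (g e i)) x)" for i
    proof -
      have "dd (vs ! i) (\<lambda>y. - (\<Sum>e\<in>Basis. dd e (g e i) y)) x
          = - dd (vs ! i) (\<lambda>y. \<Sum>e\<in>Basis. dd e (g e i) y) x"
        using U g by (intro dd_uminus diff smooth_on_sum smooth_on_dd)
      also have "dd (vs ! i) (\<lambda>y. \<Sum>e\<in>Basis. dd e (g e i) y) x
          = (\<Sum>e\<in>Basis. dd (vs ! i) (dd e (g e i)) x)"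
        using g by (intro dd_sum diff smooth_on_dd)
      finally show ?thesis .
    qed
    then show ?thesis
      by (simp add: sum_distrib_left sum_negf)
  qed
  also have "\<dots> = - (\<Sum>e\<in>Basis. \<Sum>i<length vs. (-1) ^ i * dd e (dd (vs ! i) (g e i)) x)"
    using smooth_on_dd_commute[OF U g] by (subst sum.swap) simp
  finally have 1: "exterior_derivative (codifferential \<omega>) x vs =
    - (\<Sum>e\<in>Basis. \<Sum>i<length vs. (-1) ^ i * dd e (dd (vs ! i) (g e i)) x)" .
  have "dd e (\<lambda>y. exterior_derivative \<omega> y (e # vs)) x = dd e (dd e (\<lambda>y. \<omega> y vs)) x
      - (\<Sum>i<length vs. (-1) ^ i * dd e (dd (vs ! i) (g e i)) x)" for e
  proof -
    have "dd e (\<lambda>y. exterior_derivative \<omega> y (e # vs)) x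
      = dd e (\<lambda>y. dd e (\<lambda>y. \<omega> y vs) y + - (\<Sum>i<length vs. (-1) ^ i * dd (vs ! i) (g e i) y)) x"
      by (simp add: exterior_derivative_Cons g_def)
    also have "\<dots> = dd e (dd e (\<lambda>y. \<omega> y vs)) x
      + dd e (\<lambda>y. - (\<Sum>i<length vs. (-1) ^ i * dd (vs ! i) (g e i) y)) x"
      using U g \<omega> by (intro dd_add diff smooth_on_uminus smooth_on_sum smooth_on_cmult smooth_on_dd)
    also have "dd e (\<lambda>y. - (\<Sum>i<length vs. (-1) ^ i * dd (vs ! i) (g e i) y)) x
      = - dd e (\<lambda>y. \<Sum>i<length vs. (-1) ^ i * dd (vs ! i) (g e i) y) x"
      using U g by (intro dd_uminus diff smooth_on_sum smooth_on_cmult smooth_on_dd)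
    also have "dd e (\<lambda>y. \<Sum>i<length vs. (-1) ^ i * dd (vs ! i) (g e i) y) x
      = (\<Sum>i<length vs. dd e (\<lambda>y. (-1) ^ i * dd (vs ! i) (g e i) y) x)"
      using U g by (intro dd_sum diff smooth_on_cmult smooth_on_dd)
    also have "\<dots> = (\<Sum>i<length vs. (-1) ^ i * dd e (dd (vs ! i) (g e i)) x)"
      using U g by (intro sum.cong refl dd_cmult diff smooth_on_dd)
    finally show ?thesis by simp
  qed
  then have 2: "codifferential (exterior_derivative \<omega>) x vs = laplacian (\<lambda>y. \<omega> y vs) x
    + (\<Sum>e\<in>Basis. \<Sum>i<length vs. (-1) ^ i * dd e (dd (vs ! i) (g e i)) x)"
    by (simp add: codifferential_def laplacian_def sum_subtractf)
  show ?thesis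
    by (simp add: hodge_laplacian_def 1 2)
qed

text \<open>The componentwise formula holds on \<open>U\<close> only, so smoothness of the inner
  Laplacian and the value of the outer one are carried over along equality on
  \<open>U\<close>.\<close>

lemma hodge_bilaplacian_components:
  assumes U: "open U" "x \<in> U" and \<omega>: "\<And>vs. smooth_on (\<lambda>y. \<omega> y vs) U"
  shows "hodge_laplacian (hodge_laplacian \<omega>) x vs = laplacian (laplacian (\<lambda>y. \<omega> y vs)) x"
proof -
  have eq: "laplacian (\<lambda>y. \<omega> y ws) y = hodge_laplacian \<omega> y ws" if "y \<in> U" for y ws
    using hodge_laplacian_components[OF U(1) that \<omega>] by simp
  have sm: "smooth_on (\<lambda>y. hodge_laplacian \<omega> y ws) U" for ws
    using smooth_on_cong[OF U(1) eq smooth_on_laplacian[OF U(1) \<omega>]] .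
  have "hodge_laplacian (hodge_laplacian \<omega>) x vs = laplacian (\<lambda>y. hodge_laplacian \<omega> y vs) x"
    using hodge_laplacian_components[OF U sm] .
  also have "\<dots> = laplacian (laplacian (\<lambda>y. \<omega> y vs)) x"
    using laplacian_cong[OF U(1) smooth_on_laplacian[OF U(1) \<omega>] eq U(2)] by simp
  finally show ?thesis .
qed

text \<open>As \<open>\<omega>\<close> vanishes on the boundary, differentiating along
  \<open>e\<close> there is \<open>e \<bullet> \<nu>\<close> times differentiating along the normal
  \<open>\<nu>\<close>. Linearity in the first slot then reassembles \<open>\<nu>\<close>, held
  constant at its value at \<open>x\<close>, from its basis expansion.\<close>

lemma codifferential_boundary:
  fixes M :: "'a::euclidean_space set"
  assumes M: "smooth_boundary M" "closed M" "x \<in> frontier M"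
    and U: "open U" "x \<in> U" and \<omega>: "smooth_form_on p U \<omega>"
    and zero: "\<And>y vs. y \<in> frontier M \<Longrightarrow> \<omega> y vs = 0"
  shows "codifferential \<omega> x vs
    = - dd (inward_unit_normal M x) (\<lambda>y. \<omega> y (inward_unit_normal M x # vs)) x"
proof -
  let ?\<nu> = "inward_unit_normal M x"
  have sm: "smooth_on (\<lambda>y. \<omega> y ws) U" for ws
    using \<omega> by (simp add: smooth_form_on_def)
  have diff: "(\<lambda>y. \<omega> y ws) differentiable at x" for ws
    using smooth_on_differentiable[OF sm U(2)] .
  have "(\<Sum>e\<in>Basis. dd e (\<lambda>y. \<omega> y (e # vs)) x)
      = (\<Sum>e\<in>Basis. (e \<bullet> ?\<nu>) * dd ?\<nu> (\<lambda>y. \<omega> y (e # vs)) x)"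
    by (intro sum.cong refl boundary_derivative[OF M diff] zero)
  also have "\<dots> = dd ?\<nu> (\<lambda>y. \<Sum>e\<in>Basis. (e \<bullet> ?\<nu>) * \<omega> y (e # vs)) x"
    using diff U sm
    by (simp add: dd_sum dd_cmult smooth_on_differentiable[OF smooth_on_cmult[OF U(1) sm] U(2)])
  also have "\<dots> = dd ?\<nu> (\<lambda>y. \<omega> y (?\<nu> # vs)) x"
  proof (rule dd_cong[OF _ U])
    show "(\<lambda>y. \<Sum>e\<in>Basis. (e \<bullet> ?\<nu>) * \<omega> y (e # vs)) differentiable at x"
      by (intro smooth_on_differentiable[OF _ U(2)] smooth_on_sum smooth_on_cmult U sm)
    fix y assume "y \<in> U"
    then have "linear (\<lambda>v. \<omega> y (v # vs))"
      using \<omega> alternating_covector_linear_Cons by (auto simp: smooth_form_on_def)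
    then have "\<omega> y ((\<Sum>e\<in>Basis. (?\<nu> \<bullet> e) *\<^sub>R e) # vs) = (\<Sum>e\<in>Basis. \<omega> y (((?\<nu> \<bullet> e) *\<^sub>R e) # vs))"
      by (rule linear_sum)
    also have "\<dots> = (\<Sum>e\<in>Basis. (?\<nu> \<bullet> e) * \<omega> y (e # vs))"
      using linear_cmul[OF \<open>linear (\<lambda>v. \<omega> y (v # vs))\<close>] by simp
    finally have "\<omega> y ((\<Sum>e\<in>Basis. (?\<nu> \<bullet> e) *\<^sub>R e) # vs) = (\<Sum>e\<in>Basis. (?\<nu> \<bullet> e) * \<omega> y (e # vs))" .
    then show "(\<Sum>e\<in>Basis. (e \<bullet> ?\<nu>) * \<omega> y (e # vs)) = \<omega> y (?\<nu> # vs)"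
      by (simp add: euclidean_representation inner_commute[of _ ?\<nu>])
  qed
  finally show ?thesis
    by (simp add: codifferential_def)
qed

text \<open>Every other term of \<open>d\<close> differentiates a function vanishing on the boundary
  along a tangent vector.\<close>

lemma exterior_derivative_boundary:
  fixes M :: "'a::euclidean_space set"
  assumes M: "smooth_boundary M" "closed M" "x \<in> frontier M"
    and diff: "\<And>vs. (\<lambda>y. \<omega> y vs) differentiable at x"
    and zero: "\<And>y vs. y \<in> frontier M \<Longrightarrow> \<omega> y vs = 0"
    and vs: "vs \<in> lists (boundary_tangent_space M x)"
  shows "exterior_derivative \<omega> x (v # vs) = dd v (\<lambda>y. \<omega> y vs) x"
proof -
  have "dd (vs ! i) (\<lambda>y. \<omega> y ws) x = 0" if "i < length vs" for i ws
    using vs that by (intro tangential_derivative_zero[OF M diff] zero) auto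
  then show ?thesis
    by (simp add: exterior_derivative_Cons)
qed

text \<open>Naming the scalar boundary expression allows it to be read, at fixed \<open>x\<close>,
  as a function of the argument list of a form.\<close>

definition steklov_defect ::
    "'a::euclidean_space set \<Rightarrow> real \<Rightarrow> ('a \<Rightarrow> real) \<Rightarrow> 'a \<Rightarrow> real" where
  "steklov_defect M q f x = laplacian f x - q * dd (inward_unit_normal M x) f x"

text \<open>The defect is linear in the function and, for smooth functions, depends only on values
  near \<open>x\<close>, so the alternating property is inherited from \<open>\<omega> y\<close> for
  \<open>y\<close> in \<open>U\<close>.\<close>

lemma alternating_covector_steklov_defect:
  assumes U: "open U" "x \<in> U" and \<omega>: "smooth_form_on p U \<omega>"
  shows "alternating_covector p (\<lambda>vs. steklov_defect M q (\<lambda>y. \<omega> y vs) x)"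
proof -
  have sm: "smooth_on (\<lambda>y. \<omega> y ws) U" and alt: "y \<in> U \<Longrightarrow> alternating_covector p (\<omega> y)" for y ws
    using \<omega> by (auto simp: smooth_form_on_def)
  have diff: "f differentiable at x" if "smooth_on f U" for f
    using smooth_on_differentiable[OF that U(2)] .
  have cong: "steklov_defect M q f x = steklov_defect M q g x"
    if "smooth_on f U" "\<And>y. y \<in> U \<Longrightarrow> f y = g y" for f g
    using laplacian_cong[OF U(1) that U(2)] dd_cong[OF diff[OF that(1)] U that(2)]
    by (simp add: steklov_defect_def)
  have zero: "steklov_defect M q (\<lambda>y. \<omega> y vs) x = 0" if "\<And>y. y \<in> U \<Longrightarrow> \<omega> y vs = 0" for vs
    using cong[OF sm that] by (simp add: steklov_defect_def laplacian_def)
  show ?thesis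
    unfolding alternating_covector_def
  proof (intro conjI allI impI)
    fix vs :: "'a list" and i
    assume vs: "length vs = p" "i < p"
    have lin: "linear (\<lambda>v. \<omega> y (vs[i := v]))" if "y \<in> U" for y
      using alt[OF that] vs by (simp add: alternating_covector_def)
    show "linear (\<lambda>v. steklov_defect M q (\<lambda>y. \<omega> y (vs[i := v])) x)"
    proof (rule linearI)
      fix v w
      have "steklov_defect M q (\<lambda>y. \<omega> y (vs[i := v + w])) x
          = steklov_defect M q (\<lambda>y. \<omega> y (vs[i := v]) + \<omega> y (vs[i := w])) x"
        by (rule cong[OF sm]) (rule linear_add[OF lin])
      then show "steklov_defect M q (\<lambda>y. \<omega> y (vs[i := v + w])) x
          = steklov_defect M q (\<lambda>y. \<omega> y (vs[i := v])) x + steklov_defect M q (\<lambda>y. \<omega> y (vs[i := w])) x"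
        by (simp add: steklov_defect_def laplacian_add[OF U(1) sm sm U(2)] dd_add diff[OF sm] algebra_simps)
    next
      fix c v
      have "steklov_defect M q (\<lambda>y. \<omega> y (vs[i := c *\<^sub>R v])) x
          = steklov_defect M q (\<lambda>y. c * \<omega> y (vs[i := v])) x"
        by (rule cong[OF sm]) (simp add: linear_cmul[OF lin])
      then show "steklov_defect M q (\<lambda>y. \<omega> y (vs[i := c *\<^sub>R v])) x
          = c *\<^sub>R steklov_defect M q (\<lambda>y. \<omega> y (vs[i := v])) x"
        by (simp add: steklov_defect_def laplacian_cmult[OF U(1) sm U(2)] dd_cmult diff[OF sm] algebra_simps)
    qed
  qed (use zero alt in \<open>auto simp: alternating_covector_def\<close>)
qed

text \<open>The minus sign in the codifferential turns \<open>+ q\<close> into the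
  \<open>- q\<close> of the scalar condition. For tangential \<open>us\<close>, the first condition
  thus says that the defect vanishes on \<open>\<nu> # us\<close>, the second that it vanishes on
  \<open>us\<close>. Arbitrary lists follow from \<open>alternating_covector_eq_0I\<close>, applied
  to the defect itself.\<close>

lemma steklov_boundary_conditions_iff:
  fixes M :: "'a::euclidean_space set"
  assumes M: "smooth_boundary M" "closed M" "x \<in> frontier M"
    and U: "open U" "x \<in> U" and \<omega>: "smooth_form_on p U \<omega>"
    and zero: "\<And>y vs. y \<in> frontier M \<Longrightarrow> \<omega> y vs = 0"
  defines "T \<equiv> boundary_tangent_space M x" and "\<nu> \<equiv> inward_unit_normal M x"
  shows "(\<forall>vs\<in>lists T. interior_product \<nu> (hodge_laplacian \<omega> x) vs + q * codifferential \<omega> x vs = 0) \<and>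
      (\<forall>vs\<in>lists T. hodge_laplacian \<omega> x vs - q * interior_product \<nu> (exterior_derivative \<omega> x) vs = 0)
    \<longleftrightarrow> (\<forall>vs. steklov_defect M q (\<lambda>y. \<omega> y vs) x = 0)"
    (is "?L \<longleftrightarrow> ?R")
proof -
  have sm: "smooth_on (\<lambda>y. \<omega> y ws) U" for ws
    using \<omega> by (auto simp: smooth_form_on_def)
  have normal: "interior_product \<nu> (hodge_laplacian \<omega> x) vs + q * codifferential \<omega> x vs
      = steklov_defect M q (\<lambda>y. \<omega> y (\<nu> # vs)) x" for vs
    by (simp add: interior_product_def steklov_defect_def hodge_laplacian_components[OF U sm] \<nu>_def
        codifferential_boundary[OF M U \<omega> zero])
  have tangential: "hodge_laplacian \<omega> x vs - q * interior_product \<nu> (exterior_derivative \<omega> x) vs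
      = steklov_defect M q (\<lambda>y. \<omega> y vs) x" if "vs \<in> lists T" for vs
    using that
    by (simp add: interior_product_def steklov_defect_def hodge_laplacian_components[OF U sm] \<nu>_def T_def
        exterior_derivative_boundary[OF M smooth_on_differentiable[OF sm U(2)] zero])
  have "norm \<nu> = 1"
    using inward_unit_normal[OF M] unfolding \<nu>_def .
  have T: "T = {v. v \<bullet> \<nu> = 0}"
    by (simp add: T_def \<nu>_def boundary_tangent_space_def)
  have ?R if L: ?L
  proof
    fix vs
    show "steklov_defect M q (\<lambda>y. \<omega> y vs) x = 0"
    proof (rule alternating_covector_eq_0I[OF alternating_covector_steklov_defect[OF U \<omega>] \<open>norm \<nu> = 1\<close>])
      fix us
      assume "us \<in> lists {v. v \<bullet> \<nu> = 0}"
      then have us: "us \<in> lists T"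
        by (simp only: T)
      show "steklov_defect M q (\<lambda>y. \<omega> y us) x = 0"
        using bspec[OF conjunct2[OF L] us] tangential[OF us] by linarith
      show "steklov_defect M q (\<lambda>y. \<omega> y (\<nu> # us)) x = 0"
        using bspec[OF conjunct1[OF L] us] normal[of us] by linarith
    qed
  qed
  moreover have ?L if ?R
    using that normal tangential by simp
  ultimately show ?thesis
    by blast
qed

text \<open>The equations decouple into one scalar problem per argument list; the components remain
  linked only by forming an alternating covector and by not all vanishing on
  \<open>M\<close>.\<close>

lemma biharmonic_steklov_eigenvalue_forms_iff:
  fixes M :: "'a::euclidean_space set"
  assumes M: "smooth_boundary M" "closed M"
  shows "biharmonic_steklov_eigenvalue_forms M p q \<longleftrightarrow>
    (\<exists>U \<omega>. open U \<and> M \<subseteq> U \<and> smooth_form_on p U \<omega> \<and> (\<exists>x\<in>M. \<exists>vs. \<omega> x vs \<noteq> 0) \<and>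
      (\<forall>vs. (\<forall>x\<in>M. laplacian (laplacian (\<lambda>y. \<omega> y vs)) x = 0) \<and>
         (\<forall>x\<in>frontier M. \<omega> x vs = 0) \<and>
         (\<forall>x\<in>frontier M. steklov_defect M q (\<lambda>y. \<omega> y vs) x = 0)))"
proof -
  let ?A = "\<lambda>\<omega>. (\<forall>x\<in>M. \<forall>vs. hodge_laplacian (hodge_laplacian \<omega>) x vs = 0) \<and>
        (\<forall>x\<in>frontier M. \<forall>vs. \<omega> x vs = 0) \<and>
        (\<forall>x\<in>frontier M. \<forall>vs\<in>lists (boundary_tangent_space M x).
           interior_product (inward_unit_normal M x) (hodge_laplacian \<omega> x) vs
             + q * codifferential \<omega> x vs = 0) \<and>
        (\<forall>x\<in>frontier M. \<forall>vs\<in>lists (boundary_tangent_space M x).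
           hodge_laplacian \<omega> x vs
             - q * interior_product (inward_unit_normal M x) (exterior_derivative \<omega> x) vs = 0)"
  let ?B = "\<lambda>\<omega>. \<forall>vs. (\<forall>x\<in>M. laplacian (laplacian (\<lambda>y. \<omega> y vs)) x = 0) \<and>
         (\<forall>x\<in>frontier M. \<omega> x vs = 0) \<and>
         (\<forall>x\<in>frontier M. steklov_defect M q (\<lambda>y. \<omega> y vs) x = 0)"
  have "?A \<omega> \<longleftrightarrow> ?B \<omega>" if U: "open U" "M \<subseteq> U" and \<omega>: "smooth_form_on p U \<omega>" for U \<omega>
  \<comment> \<open>The boundary conditions are compared for forms vanishing on the boundary; for
    any other form both sides are false.\<close>
  proof (cases "\<forall>x\<in>frontier M. \<forall>vs. \<omega> x vs = 0")
    case True
    have F: "x \<in> U" if "x \<in> frontier M" for x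
      using that U M frontier_subset_closed by blast
    have "hodge_laplacian (hodge_laplacian \<omega>) x vs = laplacian (laplacian (\<lambda>y. \<omega> y vs)) x"
      if "x \<in> M" for x vs
      using that U \<omega> by (intro hodge_bilaplacian_components[of U]) (auto simp: smooth_form_on_def)
    moreover have "(\<forall>vs\<in>lists (boundary_tangent_space M x).
           interior_product (inward_unit_normal M x) (hodge_laplacian \<omega> x) vs
             + q * codifferential \<omega> x vs = 0) \<and>
        (\<forall>vs\<in>lists (boundary_tangent_space M x).
           hodge_laplacian \<omega> x vs
             - q * interior_product (inward_unit_normal M x) (exterior_derivative \<omega> x) vs = 0)
        \<longleftrightarrow> (\<forall>vs. steklov_defect M q (\<lambda>y. \<omega> y vs) x = 0)" if "x \<in> frontier M" for x
      using True by (intro steklov_boundary_conditions_iff[OF M that U(1) F[OF that] \<omega>]) auto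
    ultimately show ?thesis
      using True by (simp only: ball_conj_distrib[symmetric] cong: ball_cong) blast
  qed auto
  then show ?thesis
    unfolding biharmonic_steklov_eigenvalue_forms_def by (intro ex_cong1 conj_cong refl)
qed

section \<open>Transfer of eigenvalues between forms and functions\<close>

lemma smooth_form_on_mult_covector:
  assumes "open U" "smooth_on f U" and \<alpha>: "alternating_covector p \<alpha>"
  shows "smooth_form_on p U (\<lambda>x vs. \<alpha> vs * f x)"
proof -
  have "linear (\<lambda>v. \<alpha> (vs[i := v]) * f x)" if "length vs = p" "i < p" for vs i x
    using \<alpha> that linear_compose_scale_right[of "\<lambda>v. \<alpha> (vs[i := v])" "f x"]
    by (simp add: alternating_covector_def mult.commute)
  then show ?thesis
    using assms by (auto simp: smooth_form_on_def alternating_covector_def intro: smooth_on_cmult)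
qed

theorem mainTheorem6:
  fixes M :: "(real ^ 'n) set" and p :: nat and q :: real
  assumes "compact M"
    and "smooth_boundary M"
    and "frontier M \<noteq> {}"
    and "p \<le> CARD('n)"
  shows "biharmonic_steklov_eigenvalue_forms M p q \<longleftrightarrow>
         biharmonic_steklov_eigenvalue_functions M q"
proof -
  have M: "closed M" "smooth_boundary M"
    using assms compact_imp_closed by blast+
  show ?thesis
  proof
    assume "biharmonic_steklov_eigenvalue_forms M p q"
    \<comment> \<open>Any argument list \<open>vs\<close> on which \<open>\<omega>\<close> is
      nonzero somewhere in \<open>M\<close> yields a scalar eigenfunction.\<close>
    then obtain U \<omega> x vs where "open U" "M \<subseteq> U" "smooth_form_on p U \<omega>" "x \<in> M" "\<omega> x vs \<noteq> 0"
      "\<forall>x\<in>M. laplacian (laplacian (\<lambda>y. \<omega> y vs)) x = 0"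
      "\<forall>x\<in>frontier M. \<omega> x vs = 0"
      "\<forall>x\<in>frontier M. steklov_defect M q (\<lambda>y. \<omega> y vs) x = 0"
      unfolding biharmonic_steklov_eigenvalue_forms_iff[OF M(2,1)] by blast
    then show "biharmonic_steklov_eigenvalue_functions M q"
      unfolding biharmonic_steklov_eigenvalue_functions_def steklov_defect_def smooth_form_on_def
      by (intro exI[of _ U] exI[of _ "\<lambda>y. \<omega> y vs"]) auto
  next
    assume "biharmonic_steklov_eigenvalue_functions M q"
    then obtain U f x where U: "open U" "M \<subseteq> U" and f: "smooth_on f U" and x: "x \<in> M" "f x \<noteq> 0"
      and sol: "\<forall>x\<in>M. laplacian (laplacian f) x = 0" "\<forall>x\<in>frontier M. f x = 0"
        "\<forall>x\<in>frontier M. steklov_defect M q f x = 0"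
      unfolding biharmonic_steklov_eigenvalue_functions_def steklov_defect_def by blast
    obtain \<alpha> :: "(real ^ 'n) covector" and vs where \<alpha>: "alternating_covector p \<alpha>" "\<alpha> vs \<noteq> 0"
      using exists_alternating_covector[OF assms(4)] .
    have F: "y \<in> U" if "y \<in> frontier M" for y
      using that U M frontier_subset_closed by blast
    \<comment> \<open>\<open>c\<close> stands for the value of the covector on an argument list:
      each component of the product form is such a multiple of \<open>f\<close>.\<close>
    have "laplacian (laplacian (\<lambda>y. c * f y)) y = 0" if "y \<in> M" for y c
    proof -
      have "y \<in> U" using that U by blast
      have "laplacian (laplacian (\<lambda>y. c * f y)) y = laplacian (\<lambda>y. c * laplacian f y) y"
        using U f \<open>y \<in> U\<close>
        by (intro laplacian_cong[of U])
          (auto intro: smooth_on_laplacian smooth_on_cmult laplacian_cmult)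
      also have "\<dots> = c * laplacian (laplacian f) y"
        using U f \<open>y \<in> U\<close> by (intro laplacian_cmult[of U] smooth_on_laplacian)
      finally show ?thesis
        using sol that by simp
    qed
    moreover have "steklov_defect M q (\<lambda>y. c * f y) y = 0" if "y \<in> frontier M" for y c
    proof -
      have "steklov_defect M q (\<lambda>y. c * f y) y = c * steklov_defect M q f y"
        using laplacian_cmult[OF U(1) f F[OF that]] dd_cmult[OF smooth_on_differentiable[OF f F[OF that]]]
        by (simp add: steklov_defect_def algebra_simps)
      then show ?thesis
        using sol that by simp
    qed
    ultimately show "biharmonic_steklov_eigenvalue_forms M p q"
      unfolding biharmonic_steklov_eigenvalue_forms_iff[OF M(2,1)]
      using U x sol \<alpha> smooth_form_on_mult_covector[OF U(1) f \<alpha>(1)]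
      by (intro exI[of _ U] exI[of _ "\<lambda>x vs. \<alpha> vs * f x"]) auto
  qed
qed

end
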